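(* Let $B\colon\mathcal{C}\to\mathcal{C}$ be an endofunctor and let $(T,\tau)$ be the companion of $B$ (so $T\colon\mathcal{C}\to\mathcal{C}$ and $\tau\colon TB\Rightarrow BT$). Then there are unique natural transformations $\eta\colon \mathrm{Id}\Rightarrow T$ and $\mu\colon TT\Rightarrow T$ such that $(T,\eta,\mu)$ is a monad and $\tau$ is a distributive law of this monad over $B$, i.e. $B\eta=\tau\circ\eta B$ and $\tau\circ\mu B=B\mu\circ\tau T\circ T\tau$.
   Context: For an endofunctor $B$, the category $\mathrm{DL}(B)$ has as objects pairs $(F,\lambda)$ with $F\colon\mathcal{C}\to\mathcal{C}$ a functor and $\lambda\colon FB\Rightarrow BF$ a natural transformation; a morphism $(F,\lambda)\to(G,\rho)$ is a natural transformation $\kappa\colon F\Rightarrow G$ with $\rho\circ\kappa B=B\kappa\circ\lambda$. The companion of $B$ is a final object of $\mathrm{DL}(B)$ (assumed to exist here). *)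

theory Defs
  imports Main "HOL-Library.FuncSet"
begin

record ('o, 'a) cat =
  Obj :: "'o set"
  Arr :: "'a set"
  Dom :: "'a \<Rightarrow> 'o"
  Cod :: "'a \<Rightarrow> 'o"
  Id :: "'o \<Rightarrow> 'a"
  Comp :: "'a \<Rightarrow> 'a \<Rightarrow> 'a" (infixr "\<cdot>\<index>" 70)

definition Hom :: "('o, 'a, 'm) cat_scheme \<Rightarrow> 'o \<Rightarrow> 'o \<Rightarrow> 'a set" where
  "Hom C X Y = {f \<in> Arr C. Dom C f = X \<and> Cod C f = Y}"

locale category =
  fixes C :: "('o, 'a) cat" (structure)
  assumes Dom_obj: "f \<in> Arr C \<Longrightarrow> Dom C f \<in> Obj C"
    and Cod_obj: "f \<in> Arr C \<Longrightarrow> Cod C f \<in> Obj C"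
    and Id_hom: "X \<in> Obj C \<Longrightarrow> Id C X \<in> Hom C X X"
    and Comp_hom: "\<lbrakk>f \<in> Hom C X Y; g \<in> Hom C Y Z\<rbrakk> \<Longrightarrow> g \<cdot> f \<in> Hom C X Z"
    and Comp_Id: "f \<in> Hom C X Y \<Longrightarrow> f \<cdot> Id C X = f"
    and Id_Comp: "f \<in> Hom C X Y \<Longrightarrow> Id C Y \<cdot> f = f"
    and Comp_assoc:
      "\<lbrakk>f \<in> Hom C W X; g \<in> Hom C X Y; h \<in> Hom C Y Z\<rbrakk> \<Longrightarrow> (h \<cdot> g) \<cdot> f = h \<cdot> (g \<cdot> f)"

definition final_object :: "('o, 'a) cat \<Rightarrow> 'o \<Rightarrow> bool" where
  "final_object C X \<longleftrightarrow> X \<in> Obj C \<and> (\<forall>Y \<in> Obj C. \<exists>!f. f \<in> Hom C Y X)"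

text \<open>
  The maps of a functor and the components of a natural transformation are required to be
  \<^const>\<open>extensional\<close>, so that HOL equality is equality of functors and of natural
  transformations; all operations below therefore use restricted abstractions.
\<close>

record ('o, 'a, 'p, 'b) cfunctor =
  obj_map :: "'o \<Rightarrow> 'p"
  arr_map :: "'a \<Rightarrow> 'b"

locale is_functor = source: category C + target: category D
  for C :: "('o, 'a) cat" and D :: "('p, 'b) cat" +
  fixes F :: "('o, 'a, 'p, 'b) cfunctor"
  assumes obj_extensional: "obj_map F \<in> extensional (Obj C)"
    and arr_extensional: "arr_map F \<in> extensional (Arr C)"
    and obj_map_obj: "X \<in> Obj C \<Longrightarrow> obj_map F X \<in> Obj D"
    and arr_map_hom: "f \<in> Hom C X Y \<Longrightarrow> arr_map F f \<in> Hom D (obj_map F X) (obj_map F Y)"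
    and arr_map_Id: "X \<in> Obj C \<Longrightarrow> arr_map F (Id C X) = Id D (obj_map F X)"
    and arr_map_Comp: "\<lbrakk>f \<in> Hom C X Y; g \<in> Hom C Y Z\<rbrakk>
      \<Longrightarrow> arr_map F (g \<cdot>\<^bsub>C\<^esub> f) = arr_map F g \<cdot>\<^bsub>D\<^esub> arr_map F f"

definition id_functor :: "('o, 'a) cat \<Rightarrow> ('o, 'a, 'o, 'a) cfunctor" where
  "id_functor C = \<lparr>obj_map = (\<lambda>X \<in> Obj C. X), arr_map = (\<lambda>f \<in> Arr C. f)\<rparr>"

definition comp_functor ::
  "('o, 'a) cat \<Rightarrow> ('p, 'b, 'q, 'c) cfunctor \<Rightarrow> ('o, 'a, 'p, 'b) cfunctor
    \<Rightarrow> ('o, 'a, 'q, 'c) cfunctor" where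
  "comp_functor C G F =
    \<lparr>obj_map = (\<lambda>X \<in> Obj C. obj_map G (obj_map F X)),
     arr_map = (\<lambda>f \<in> Arr C. arr_map G (arr_map F f))\<rparr>"

locale nat_trans = F: is_functor C D F + G: is_functor C D G
  for C :: "('o, 'a) cat" and D :: "('p, 'b) cat"
    and F G :: "('o, 'a, 'p, 'b) cfunctor" +
  fixes \<alpha> :: "'o \<Rightarrow> 'b"
  assumes component_extensional: "\<alpha> \<in> extensional (Obj C)"
    and component_hom: "X \<in> Obj C \<Longrightarrow> \<alpha> X \<in> Hom D (obj_map F X) (obj_map G X)"
    and naturality: "f \<in> Hom C X Y
      \<Longrightarrow> \<alpha> Y \<cdot>\<^bsub>D\<^esub> arr_map F f = arr_map G f \<cdot>\<^bsub>D\<^esub> \<alpha> X"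

definition id_nt ::
  "('o, 'a) cat \<Rightarrow> ('p, 'b) cat \<Rightarrow> ('o, 'a, 'p, 'b) cfunctor \<Rightarrow> 'o \<Rightarrow> 'b" where
  "id_nt C D F = (\<lambda>X \<in> Obj C. Id D (obj_map F X))"

definition comp_nt ::
  "('o, 'a) cat \<Rightarrow> ('p, 'b) cat \<Rightarrow> ('o \<Rightarrow> 'b) \<Rightarrow> ('o \<Rightarrow> 'b) \<Rightarrow> 'o \<Rightarrow> 'b" where
  "comp_nt C D \<beta> \<alpha> = (\<lambda>X \<in> Obj C. \<beta> X \<cdot>\<^bsub>D\<^esub> \<alpha> X)"

text \<open>For functors out of the category \<open>C\<close>: \<open>nt_functor C \<alpha> F\<close> is the whiskering \<open>\<alpha>F\<close>
  and \<open>functor_nt C F \<alpha>\<close> is the whiskering \<open>F\<alpha>\<close>.\<close>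

definition nt_functor ::
  "('o, 'a) cat \<Rightarrow> ('p \<Rightarrow> 'c) \<Rightarrow> ('o, 'a, 'p, 'b) cfunctor \<Rightarrow> 'o \<Rightarrow> 'c" where
  "nt_functor C \<alpha> F = (\<lambda>X \<in> Obj C. \<alpha> (obj_map F X))"

definition functor_nt ::
  "('o, 'a) cat \<Rightarrow> ('p, 'b, 'q, 'c) cfunctor \<Rightarrow> ('o \<Rightarrow> 'b) \<Rightarrow> 'o \<Rightarrow> 'c" where
  "functor_nt C F \<alpha> = (\<lambda>X \<in> Obj C. arr_map F (\<alpha> X))"

type_synonym ('o, 'a) endo = "('o, 'a, 'o, 'a) cfunctor"

definition DL_obj :: "('o, 'a) cat \<Rightarrow> ('o, 'a) endo \<Rightarrow> (('o, 'a) endo \<times> ('o \<Rightarrow> 'a)) set" where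
  "DL_obj C B = {(F, l). is_functor C C F \<and>
     nat_trans C C (comp_functor C F B) (comp_functor C B F) l}"

definition DL_morphism ::
  "('o, 'a) cat \<Rightarrow> ('o, 'a) endo \<Rightarrow> ('o, 'a) endo \<times> ('o \<Rightarrow> 'a) \<Rightarrow> ('o, 'a) endo \<times> ('o \<Rightarrow> 'a)
    \<Rightarrow> ('o \<Rightarrow> 'a) \<Rightarrow> bool" where
  "DL_morphism C B = (\<lambda>(F, l) (G, r) k. nat_trans C C F G k \<and>
     comp_nt C C r (nt_functor C k B) = comp_nt C C (functor_nt C B k) l)"

text \<open>Arrows carry their source and target, since a family of components does not determine them.\<close>

definition DL :: "('o, 'a) cat \<Rightarrow> ('o, 'a) endo \<Rightarrow>
    (('o, 'a) endo \<times> ('o \<Rightarrow> 'a),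
     (('o, 'a) endo \<times> ('o \<Rightarrow> 'a)) \<times> ('o \<Rightarrow> 'a) \<times> (('o, 'a) endo \<times> ('o \<Rightarrow> 'a))) cat" where
  "DL C B =
    \<lparr>Obj = DL_obj C B,
     Arr = {(x, k, y). x \<in> DL_obj C B \<and> y \<in> DL_obj C B \<and> DL_morphism C B x y k},
     Dom = (\<lambda>(x, k, y). x),
     Cod = (\<lambda>(x, k, y). y),
     Id = (\<lambda>x. (x, id_nt C C (fst x), x)),
     Comp = (\<lambda>(y', k', z) (x, k, y). (x, comp_nt C C k' k, z))\<rparr>"

definition companion ::
  "('o, 'a) cat \<Rightarrow> ('o, 'a) endo \<Rightarrow> ('o, 'a) endo \<Rightarrow> ('o \<Rightarrow> 'a) \<Rightarrow> bool" where
  "companion C B T \<tau> \<longleftrightarrow> final_object (DL C B) (T, \<tau>)"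

locale monad =
  T: is_functor C C T +
  unit: nat_trans C C "id_functor C" T \<eta> +
  mult: nat_trans C C "comp_functor C T T" T \<mu>
  for C :: "('o, 'a) cat" and T :: "('o, 'a) endo" and \<eta> \<mu> :: "'o \<Rightarrow> 'a" +
  assumes assoc: "comp_nt C C \<mu> (functor_nt C T \<mu>) = comp_nt C C \<mu> (nt_functor C \<mu> T)"
    and left_unit: "comp_nt C C \<mu> (nt_functor C \<eta> T) = id_nt C C T"
    and right_unit: "comp_nt C C \<mu> (functor_nt C T \<eta>) = id_nt C C T"

locale distributive_law =
  monad C T \<eta> \<mu> +
  B: is_functor C C B +
  law: nat_trans C C "comp_functor C T B" "comp_functor C B T" \<tau>
  for C :: "('o, 'a) cat" and T :: "('o, 'a) endo" and \<eta> \<mu> :: "'o \<Rightarrow> 'a"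
    and B :: "('o, 'a) endo" and \<tau> :: "'o \<Rightarrow> 'a" +
  assumes unit_law: "functor_nt C B \<eta> = comp_nt C C \<tau> (nt_functor C \<eta> B)"
    and mult_law: "comp_nt C C \<tau> (nt_functor C \<mu> B) =
      comp_nt C C (functor_nt C B \<mu>) (comp_nt C C (nt_functor C \<tau> T) (functor_nt C T \<tau>))"

lemma nat_trans_id_nt:
  assumes "is_functor C D F" shows "nat_trans C D F F (id_nt C D F)"
proof -
  interpret is_functor C D F by fact
  show ?thesis
  proof
    fix f X Y assume f: "f \<in> Hom C X Y"
    then have "X \<in> Obj C" "Y \<in> Obj C"
      using source.Dom_obj source.Cod_obj by (auto simp: Hom_def)
    then show "id_nt C D F Y \<cdot>\<^bsub>D\<^esub> arr_map F f = arr_map F f \<cdot>\<^bsub>D\<^esub> id_nt C D F X"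
      using arr_map_hom[OF f] by (simp add: id_nt_def target.Comp_Id target.Id_Comp)
  qed (auto simp: id_nt_def target.Id_hom obj_map_obj)
qed

lemma nat_trans_comp_nt:
  assumes "nat_trans C D F G \<alpha>" and "nat_trans C D G H \<beta>"
  shows "nat_trans C D F H (comp_nt C D \<beta> \<alpha>)"
proof -
  interpret a: nat_trans C D F G \<alpha> by fact
  interpret b: nat_trans C D G H \<beta> by fact
  show ?thesis
  proof
    fix f X Y assume f: "f \<in> Hom C X Y"
    then have X: "X \<in> Obj C" and Y: "Y \<in> Obj C"
      using a.F.source.Dom_obj a.F.source.Cod_obj by (auto simp: Hom_def)
    have "(\<beta> Y \<cdot>\<^bsub>D\<^esub> \<alpha> Y) \<cdot>\<^bsub>D\<^esub> arr_map F f = \<beta> Y \<cdot>\<^bsub>D\<^esub> (\<alpha> Y \<cdot>\<^bsub>D\<^esub> arr_map F f)"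
      using a.F.arr_map_hom[OF f] a.component_hom[OF Y] b.component_hom[OF Y]
      by (rule a.F.target.Comp_assoc)
    also have "\<dots> = \<beta> Y \<cdot>\<^bsub>D\<^esub> (arr_map G f \<cdot>\<^bsub>D\<^esub> \<alpha> X)"
      using a.naturality[OF f] by simp
    also have "\<dots> = (\<beta> Y \<cdot>\<^bsub>D\<^esub> arr_map G f) \<cdot>\<^bsub>D\<^esub> \<alpha> X"
      using a.component_hom[OF X] a.G.arr_map_hom[OF f] b.component_hom[OF Y]
      by (rule a.F.target.Comp_assoc[symmetric])
    also have "\<dots> = (arr_map H f \<cdot>\<^bsub>D\<^esub> \<beta> X) \<cdot>\<^bsub>D\<^esub> \<alpha> X"
      using b.naturality[OF f] by simp
    also have "\<dots> = arr_map H f \<cdot>\<^bsub>D\<^esub> (\<beta> X \<cdot>\<^bsub>D\<^esub> \<alpha> X)"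
      using a.component_hom[OF X] b.component_hom[OF X] b.G.arr_map_hom[OF f]
      by (rule a.F.target.Comp_assoc)
    finally show "comp_nt C D \<beta> \<alpha> Y \<cdot>\<^bsub>D\<^esub> arr_map F f = arr_map H f \<cdot>\<^bsub>D\<^esub> comp_nt C D \<beta> \<alpha> X"
      using X Y by (simp add: comp_nt_def)
  next
    fix X assume "X \<in> Obj C"
    then show "comp_nt C D \<beta> \<alpha> X \<in> Hom D (obj_map F X) (obj_map H X)"
      using a.F.target.Comp_hom[OF a.component_hom b.component_hom] by (simp add: comp_nt_def)
  qed (simp add: comp_nt_def)
qed

lemma Hom_DL:
  "Hom (DL C B) x y = {(x, k, y) | k. x \<in> DL_obj C B \<and> y \<in> DL_obj C B \<and> DL_morphism C B x y k}"
  by (auto simp: Hom_def DL_def)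

lemma DL_morphism_id:
  assumes B: "is_functor C C B" and x: "x \<in> DL_obj C B"
  shows "DL_morphism C B x x (id_nt C C (fst x))"
proof -
  obtain F l where xe: "x = (F, l)" by (cases x)
  interpret B: is_functor C C B by fact
  have F: "is_functor C C F"
    and l: "nat_trans C C (comp_functor C F B) (comp_functor C B F) l"
    using x by (auto simp: xe DL_obj_def)
  interpret F: is_functor C C F by fact
  interpret l: nat_trans C C "comp_functor C F B" "comp_functor C B F" l by fact
  have "comp_nt C C l (nt_functor C (id_nt C C F) B) = comp_nt C C (functor_nt C B (id_nt C C F)) l"
    unfolding comp_nt_def
  proof (rule restrict_ext)
    fix X assume X: "X \<in> Obj C"
    have h: "l X \<in> Hom C (obj_map F (obj_map B X)) (obj_map B (obj_map F X))"
      using l.component_hom[OF X] X by (simp add: comp_functor_def)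
    show "l X \<cdot>\<^bsub>C\<^esub> nt_functor C (id_nt C C F) B X = functor_nt C B (id_nt C C F) X \<cdot>\<^bsub>C\<^esub> l X"
      using X B.obj_map_obj[OF X] F.obj_map_obj[OF X]
      by (simp add: nt_functor_def functor_nt_def id_nt_def B.arr_map_Id
          B.source.Comp_Id[OF h] B.source.Id_Comp[OF h])
  qed
  then show ?thesis using nat_trans_id_nt[OF F] by (simp add: xe DL_morphism_def)
qed

lemma DL_morphism_comp:
  assumes B: "is_functor C C B"
    and obj: "x \<in> DL_obj C B" "y \<in> DL_obj C B" "z \<in> DL_obj C B"
    and k: "DL_morphism C B x y k" and k': "DL_morphism C B y z k'"
  shows "DL_morphism C B x z (comp_nt C C k' k)"
proof -
  obtain F l G m H n where e: "x = (F, l)" "y = (G, m)" "z = (H, n)"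
    by (cases x, cases y, cases z)
  interpret B: is_functor C C B by fact
  interpret l: nat_trans C C "comp_functor C F B" "comp_functor C B F" l
    using obj by (auto simp: e DL_obj_def)
  interpret m: nat_trans C C "comp_functor C G B" "comp_functor C B G" m
    using obj by (auto simp: e DL_obj_def)
  interpret n: nat_trans C C "comp_functor C H B" "comp_functor C B H" n
    using obj by (auto simp: e DL_obj_def)
  interpret k: nat_trans C C F G k using k by (auto simp: e DL_morphism_def)
  interpret k': nat_trans C C G H k' using k' by (auto simp: e DL_morphism_def)
  note assoc = B.source.Comp_assoc
  have "comp_nt C C n (nt_functor C (comp_nt C C k' k) B) =
      comp_nt C C (functor_nt C B (comp_nt C C k' k)) l"
    unfolding comp_nt_def[of C C n] comp_nt_def[of _ _ _ l]
  proof (rule restrict_ext)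
    fix X assume X: "X \<in> Obj C"
    note BX = B.obj_map_obj[OF X]
    have hl: "l X \<in> Hom C (obj_map F (obj_map B X)) (obj_map B (obj_map F X))"
      using l.component_hom[OF X] X by (simp add: comp_functor_def)
    have hm: "m X \<in> Hom C (obj_map G (obj_map B X)) (obj_map B (obj_map G X))"
      using m.component_hom[OF X] X by (simp add: comp_functor_def)
    have hn: "n X \<in> Hom C (obj_map H (obj_map B X)) (obj_map B (obj_map H X))"
      using n.component_hom[OF X] X by (simp add: comp_functor_def)
    have sq: "m X \<cdot>\<^bsub>C\<^esub> k (obj_map B X) = arr_map B (k X) \<cdot>\<^bsub>C\<^esub> l X"
      using k X unfolding e DL_morphism_def
      by (auto simp: comp_nt_def nt_functor_def functor_nt_def dest!: fun_cong[where x = X])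
    have sq': "n X \<cdot>\<^bsub>C\<^esub> k' (obj_map B X) = arr_map B (k' X) \<cdot>\<^bsub>C\<^esub> m X"
      using k' X unfolding e DL_morphism_def
      by (auto simp: comp_nt_def nt_functor_def functor_nt_def dest!: fun_cong[where x = X])
    note hk = k.component_hom[OF X] and hk' = k'.component_hom[OF X]
    note Bk = B.arr_map_hom[OF hk] and Bk' = B.arr_map_hom[OF hk']
    have "n X \<cdot>\<^bsub>C\<^esub> (k' (obj_map B X) \<cdot>\<^bsub>C\<^esub> k (obj_map B X)) =
        (arr_map B (k' X) \<cdot>\<^bsub>C\<^esub> m X) \<cdot>\<^bsub>C\<^esub> k (obj_map B X)"
      using assoc[OF k.component_hom[OF BX] k'.component_hom[OF BX] hn] sq' by simp
    also have "\<dots> = arr_map B (k' X) \<cdot>\<^bsub>C\<^esub> (arr_map B (k X) \<cdot>\<^bsub>C\<^esub> l X)"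
      using assoc[OF k.component_hom[OF BX] hm Bk'] sq by simp
    also have "\<dots> = arr_map B (k' X \<cdot>\<^bsub>C\<^esub> k X) \<cdot>\<^bsub>C\<^esub> l X"
      using assoc[OF hl Bk Bk'] B.arr_map_Comp[OF hk hk'] by simp
    finally show "n X \<cdot>\<^bsub>C\<^esub> nt_functor C (comp_nt C C k' k) B X =
        functor_nt C B (comp_nt C C k' k) X \<cdot>\<^bsub>C\<^esub> l X"
      using X BX by (simp add: nt_functor_def functor_nt_def comp_nt_def)
  qed
  then show ?thesis
    using nat_trans_comp_nt[OF k.nat_trans_axioms k'.nat_trans_axioms]
    by (simp add: e DL_morphism_def)
qed

theorem category_DL:
  assumes B: "is_functor C C B" shows "category (DL C B)"
proof -
  interpret B: is_functor C C B by fact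
  have nt: "nat_trans C C (fst x) (fst y) k" if "DL_morphism C B x y k" for x y k
    using that by (auto simp: DL_morphism_def split: prod.splits)
  have obj: "X \<in> Obj C \<Longrightarrow> k X \<in> Hom C (obj_map (fst x) X) (obj_map (fst y) X)"
    and ext: "k \<in> extensional (Obj C)"
    if "DL_morphism C B x y k" for x y k X
    using nt[OF that] by (auto simp: nat_trans.component_hom nat_trans.component_extensional)
  show ?thesis
  proof
    fix f X Y assume f: "f \<in> Hom (DL C B) X Y"
    then obtain k where fe: "f = (X, k, Y)" and k: "DL_morphism C B X Y k"
      by (auto simp: Hom_DL)
    have "comp_nt C C k (id_nt C C (fst X)) = k"
      by (rule extensionalityI[of _ "Obj C", OF _ ext[OF k]])
        (auto simp: comp_nt_def id_nt_def B.source.Comp_Id[OF obj[OF k]])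
    then show "f \<cdot>\<^bsub>DL C B\<^esub> Id (DL C B) X = f" by (simp add: fe DL_def)
    have "comp_nt C C (id_nt C C (fst Y)) k = k"
      by (rule extensionalityI[of _ "Obj C", OF _ ext[OF k]])
        (auto simp: comp_nt_def id_nt_def B.source.Id_Comp[OF obj[OF k]])
    then show "Id (DL C B) Y \<cdot>\<^bsub>DL C B\<^esub> f = f" by (simp add: fe DL_def)
  next
    fix f g h W X Y Z
    assume "f \<in> Hom (DL C B) W X" "g \<in> Hom (DL C B) X Y" "h \<in> Hom (DL C B) Y Z"
    then obtain k k' k'' where e: "f = (W, k, X)" "g = (X, k', Y)" "h = (Y, k'', Z)"
      and k: "DL_morphism C B W X k" "DL_morphism C B X Y k'" "DL_morphism C B Y Z k''"
      by (auto simp: Hom_DL)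
    have "comp_nt C C (comp_nt C C k'' k') k = comp_nt C C k'' (comp_nt C C k' k)"
      unfolding comp_nt_def
      by (rule restrict_ext)
        (simp add: B.source.Comp_assoc[OF obj[OF k(1)] obj[OF k(2)] obj[OF k(3)]])
    then show "(h \<cdot>\<^bsub>DL C B\<^esub> g) \<cdot>\<^bsub>DL C B\<^esub> f = h \<cdot>\<^bsub>DL C B\<^esub> (g \<cdot>\<^bsub>DL C B\<^esub> f)"
      by (simp add: e DL_def)
  next
    fix f g X Y Z
    assume "f \<in> Hom (DL C B) X Y" "g \<in> Hom (DL C B) Y Z"
    then show "g \<cdot>\<^bsub>DL C B\<^esub> f \<in> Hom (DL C B) X Z"
      by (auto simp: Hom_DL) (auto simp: DL_def intro: DL_morphism_comp[OF B])
  next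
    fix X assume "X \<in> Obj (DL C B)"
    then show "Id (DL C B) X \<in> Hom (DL C B) X X"
      using DL_morphism_id[OF B, of X] by (simp add: Hom_def DL_def)
  qed (auto simp: DL_def)
qed

end

theory Submission imports Defs begin

text \<open>
  \<open>DL(B)\<close> is strict monoidal under \<open>(F, l) \<otimes> (G, m) = (FG, lG \<circ> Fm)\<close>, with unit \<open>(Id, id)\<close>.
  A final object of a monoidal category carries a unique monoid structure, all monoid equations
  holding because their two sides are parallel arrows into the final object. A monoid structure
  on \<open>(T, \<tau>)\<close> in \<open>DL(B)\<close> is precisely a monad structure on \<open>T\<close> for which \<open>\<tau>\<close> is a distributive
  law.
\<close>

section \<open>Composition of functors and whiskering\<close>

lemma is_functor_arr_map_Arr:
  assumes "is_functor C D F" and "f \<in> Arr C"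
  shows "arr_map F f \<in> Arr D"
  using is_functor.arr_map_hom[OF assms(1), of f "Dom C f" "Cod C f"] assms(2)
  by (simp add: Hom_def)

lemma (in category) Hom_objD:
  assumes "f \<in> Hom C X Y"
  shows "X \<in> Obj C" and "Y \<in> Obj C"
  using assms Dom_obj Cod_obj by (auto simp: Hom_def)

lemma obj_map_comp_functor [simp]:
  "X \<in> Obj C \<Longrightarrow> obj_map (comp_functor C G F) X = obj_map G (obj_map F X)"
  by (simp add: comp_functor_def)

lemma arr_map_comp_functor:
  "f \<in> Hom C X Y \<Longrightarrow> arr_map (comp_functor C G F) f = arr_map G (arr_map F f)"
  by (simp add: comp_functor_def Hom_def)

lemma is_functor_id_functor:
  assumes "category C" shows "is_functor C C (id_functor C)"
proof -
  interpret category C by fact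
  show ?thesis
  proof
    fix f g X Y Z assume "f \<in> Hom C X Y" "g \<in> Hom C Y Z"
    then show "arr_map (id_functor C) (g \<cdot>\<^bsub>C\<^esub> f) =
        arr_map (id_functor C) g \<cdot>\<^bsub>C\<^esub> arr_map (id_functor C) f"
      using Comp_hom[of f X Y g Z] by (simp add: id_functor_def Hom_def)
  next
    fix X assume "X \<in> Obj C"
    then show "arr_map (id_functor C) (Id C X) = Id C (obj_map (id_functor C) X)"
      using Id_hom[of X] by (simp add: id_functor_def Hom_def)
  qed (auto simp: id_functor_def Hom_def Dom_obj Cod_obj)
qed

lemma is_functor_comp_functor:
  assumes "is_functor C D F" and "is_functor D E G"
  shows "is_functor C E (comp_functor C G F)"
proof -
  interpret F: is_functor C D F by fact
  interpret G: is_functor D E G by fact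
  show ?thesis
  proof
    fix f X Y assume f: "f \<in> Hom C X Y"
    show "arr_map (comp_functor C G F) f
        \<in> Hom E (obj_map (comp_functor C G F) X) (obj_map (comp_functor C G F) Y)"
      using G.arr_map_hom[OF F.arr_map_hom[OF f]] F.source.Hom_objD[OF f]
      by (simp add: arr_map_comp_functor[OF f])
  next
    fix X assume X: "X \<in> Obj C"
    show "arr_map (comp_functor C G F) (Id C X) = Id E (obj_map (comp_functor C G F) X)"
      using X F.obj_map_obj[OF X]
      by (simp add: arr_map_comp_functor[OF F.source.Id_hom] F.arr_map_Id G.arr_map_Id)
  next
    fix f g X Y Z assume f: "f \<in> Hom C X Y" and g: "g \<in> Hom C Y Z"
    show "arr_map (comp_functor C G F) (g \<cdot>\<^bsub>C\<^esub> f) =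
        arr_map (comp_functor C G F) g \<cdot>\<^bsub>E\<^esub> arr_map (comp_functor C G F) f"
      using F.arr_map_Comp[OF f g] G.arr_map_Comp[OF F.arr_map_hom[OF f] F.arr_map_hom[OF g]]
      by (simp add: arr_map_comp_functor[OF f] arr_map_comp_functor[OF g]
          arr_map_comp_functor[OF F.source.Comp_hom[OF f g]])
  qed (simp_all add: comp_functor_def F.obj_map_obj G.obj_map_obj)
qed

text \<open>This equality holds on the nose: \<open>F\<close> sends \<open>Obj C\<close> and
  \<open>Arr C\<close> into \<open>Obj D\<close> and \<open>Arr D\<close>, where the inner
  restriction in \<open>comp_functor D H G\<close> has no effect. Strict associativity of
  \<open>DL_tensor\<close> is built on it.\<close>

lemma comp_functor_assoc:
  assumes "is_functor C D F"
  shows "comp_functor C (comp_functor D H G) F = comp_functor C H (comp_functor C G F)"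
  using is_functor.obj_map_obj[OF assms] is_functor_arr_map_Arr[OF assms]
  by (auto simp: comp_functor_def fun_eq_iff restrict_def)

text \<open>Outside \<open>Obj C\<close> and \<open>Arr C\<close> both sides are
  \<open>undefined\<close>, the right-hand one by extensionality of \<open>F\<close>; hence equality
  and not merely isomorphism.\<close>

lemma comp_functor_id_right:
  assumes "is_functor C D F"
  shows "comp_functor C F (id_functor C) = F"
proof -
  interpret is_functor C D F by fact
  show ?thesis
    using obj_extensional arr_extensional
    by (intro cfunctor.equality)
      (auto simp: comp_functor_def id_functor_def fun_eq_iff restrict_def extensional_def)
qed

lemma comp_functor_id_left:
  assumes "is_functor C D F"
  shows "comp_functor C (id_functor D) F = F"
proof -
  interpret is_functor C D F by fact
  show ?thesis
    using obj_extensional arr_extensional obj_map_obj is_functor_arr_map_Arr[OF assms]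
    by (intro cfunctor.equality)
      (auto simp: comp_functor_def id_functor_def fun_eq_iff restrict_def extensional_def)
qed

text \<open>The naturality square at \<open>f\<close> is that of \<open>\<alpha>\<close> at
  \<open>arr_map H f\<close>.\<close>

lemma nat_trans_nt_functor:
  assumes "is_functor C D H" and "nat_trans D E F G \<alpha>"
  shows "nat_trans C E (comp_functor C F H) (comp_functor C G H) (nt_functor C \<alpha> H)"
proof -
  interpret H: is_functor C D H by fact
  interpret nat_trans D E F G \<alpha> by fact
  interpret FH: is_functor C E "comp_functor C F H"
    by (rule is_functor_comp_functor) unfold_locales
  interpret GH: is_functor C E "comp_functor C G H"
    by (rule is_functor_comp_functor) unfold_locales
  show ?thesis
  proof
    fix f X Y assume f: "f \<in> Hom C X Y"
    show "nt_functor C \<alpha> H Y \<cdot>\<^bsub>E\<^esub> arr_map (comp_functor C F H) f =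
        arr_map (comp_functor C G H) f \<cdot>\<^bsub>E\<^esub> nt_functor C \<alpha> H X"
      using naturality[OF H.arr_map_hom[OF f]] H.source.Hom_objD[OF f]
      by (simp add: nt_functor_def arr_map_comp_functor[OF f])
  qed (simp_all add: nt_functor_def component_hom H.obj_map_obj)
qed

text \<open>The naturality square at \<open>f\<close> is the image under \<open>H\<close> of that of
  \<open>\<alpha>\<close> at \<open>f\<close>.\<close>

lemma nat_trans_functor_nt:
  assumes "is_functor D E H" and "nat_trans C D F G \<alpha>"
  shows "nat_trans C E (comp_functor C H F) (comp_functor C H G) (functor_nt C H \<alpha>)"
proof -
  interpret H: is_functor D E H by fact
  interpret nat_trans C D F G \<alpha> by fact
  interpret HF: is_functor C E "comp_functor C H F"
    by (rule is_functor_comp_functor) unfold_locales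
  interpret HG: is_functor C E "comp_functor C H G"
    by (rule is_functor_comp_functor) unfold_locales
  show ?thesis
  proof
    fix f X Y assume f: "f \<in> Hom C X Y"
    note XY = F.source.Hom_objD[OF f]
    show "functor_nt C H \<alpha> Y \<cdot>\<^bsub>E\<^esub> arr_map (comp_functor C H F) f =
        arr_map (comp_functor C H G) f \<cdot>\<^bsub>E\<^esub> functor_nt C H \<alpha> X"
      using naturality[OF f] XY
        H.arr_map_Comp[OF F.arr_map_hom[OF f] component_hom[OF XY(2)]]
        H.arr_map_Comp[OF component_hom[OF XY(1)] G.arr_map_hom[OF f]]
      by (simp add: functor_nt_def arr_map_comp_functor[OF f])
  qed (simp_all add: functor_nt_def H.arr_map_hom component_hom)
qed

section \<open>The monoidal structure of DL\<close>

text \<open>A law for the identity functor goes from \<open>Id B\<close> to \<open>B Id\<close>.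
  Both composites equal \<open>B\<close> strictly for a functor \<open>B\<close>, so the identity of
  \<open>B\<close> can serve.\<close>

definition DL_unit :: "('o, 'a) cat \<Rightarrow> ('o, 'a) endo \<Rightarrow> ('o, 'a) endo \<times> ('o \<Rightarrow> 'a)" where
  "DL_unit C B = (id_functor C, id_nt C C B)"

definition DL_tensor :: "('o, 'a) cat \<Rightarrow> ('o, 'a) endo \<times> ('o \<Rightarrow> 'a)
    \<Rightarrow> ('o, 'a) endo \<times> ('o \<Rightarrow> 'a) \<Rightarrow> ('o, 'a) endo \<times> ('o \<Rightarrow> 'a)" where
  "DL_tensor C = (\<lambda>(F, l) (G, m).
     (comp_functor C F G, comp_nt C C (nt_functor C l G) (functor_nt C F m)))"

lemma DL_objD:
  assumes "(F, l) \<in> DL_obj C B"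
  shows "is_functor C C F"
    and "nat_trans C C (comp_functor C F B) (comp_functor C B F) l"
  using assms by (auto simp: DL_obj_def)

lemma DL_obj_component_hom:
  assumes "(F, l) \<in> DL_obj C B" and "X \<in> Obj C"
  shows "l X \<in> Hom C (obj_map F (obj_map B X)) (obj_map B (obj_map F X))"
  using nat_trans.component_hom[OF DL_objD(2)[OF assms(1)] assms(2)] assms(2) by simp

lemma DL_obj_naturality:
  assumes "(F, l) \<in> DL_obj C B" and "f \<in> Hom C X Y"
  shows "l Y \<cdot>\<^bsub>C\<^esub> arr_map F (arr_map B f) = arr_map B (arr_map F f) \<cdot>\<^bsub>C\<^esub> l X"
  using nat_trans.naturality[OF DL_objD(2)[OF assms(1)] assms(2)]
  by (simp add: arr_map_comp_functor[OF assms(2)])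

lemma DL_morphism_square:
  assumes "DL_morphism C B (F, l) (G, m) k" and "X \<in> Obj C"
  shows "m X \<cdot>\<^bsub>C\<^esub> k (obj_map B X) = arr_map B (k X) \<cdot>\<^bsub>C\<^esub> l X"
  using assms unfolding DL_morphism_def
  by (auto simp: comp_nt_def nt_functor_def functor_nt_def dest!: fun_cong[where x = X])

section \<open>Strict monoidal laws on objects\<close>

lemma DL_unit_obj:
  assumes "is_functor C C B" shows "DL_unit C B \<in> DL_obj C B"
proof -
  interpret is_functor C C B by fact
  show ?thesis
    using nat_trans_id_nt[OF assms] is_functor_id_functor[OF source.category_axioms]
    by (simp add: DL_unit_def DL_obj_def comp_functor_id_left[OF assms]
        comp_functor_id_right[OF assms])
qed

text \<open>The law moves \<open>B\<close> leftwards past one functor at a time, from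
  \<open>FGB\<close> through \<open>FBG\<close> to \<open>BFG\<close>. Strict associativity of
  composition makes the endpoints of the two whiskerings match.\<close>

lemma DL_tensor_obj:
  assumes B: "is_functor C C B" and x: "x \<in> DL_obj C B" and y: "y \<in> DL_obj C B"
  shows "DL_tensor C x y \<in> DL_obj C B"
proof -
  obtain F l G m where e: "x = (F, l)" "y = (G, m)" by (cases x, cases y)
  note F = DL_objD[OF x[unfolded e]] and G = DL_objD[OF y[unfolded e]]
  have "nat_trans C C (comp_functor C (comp_functor C F G) B)
      (comp_functor C (comp_functor C F B) G) (functor_nt C F m)"
    using nat_trans_functor_nt[OF F(1) G(2)]
    by (simp add: comp_functor_assoc[OF B] comp_functor_assoc[OF G(1)])
  moreover have "nat_trans C C (comp_functor C (comp_functor C F B) G)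
      (comp_functor C B (comp_functor C F G)) (nt_functor C l G)"
    using nat_trans_nt_functor[OF G(1) F(2)]
    by (simp add: comp_functor_assoc[OF G(1)])
  ultimately show ?thesis
    using nat_trans_comp_nt is_functor_comp_functor[OF G(1) F(1)]
    by (auto simp: e DL_obj_def DL_tensor_def)
qed

lemma DL_tensor_unit_left:
  assumes "is_functor C C B" and x: "x \<in> DL_obj C B"
  shows "DL_tensor C (DL_unit C B) x = x"
proof -
  obtain F l where e: "x = (F, l)" by (cases x)
  note F = DL_objD[OF x[unfolded e]]
  interpret F: is_functor C C F by fact
  interpret l: nat_trans C C "comp_functor C F B" "comp_functor C B F" l by (fact F(2))
  have "comp_nt C C (nt_functor C (id_nt C C B) F) (functor_nt C (id_functor C) l) = l"
  proof (rule extensionalityI[OF _ l.component_extensional])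
    fix X assume X: "X \<in> Obj C"
    note h = DL_obj_component_hom[OF x[unfolded e] X]
    \<comment> \<open>The arrow map of \<open>id_functor C\<close> is restricted to
      \<open>Arr C\<close>, so it fixes \<open>l X\<close> only once this is known.\<close>
    have "l X \<in> Arr C" using h by (simp add: Hom_def)
    then show "comp_nt C C (nt_functor C (id_nt C C B) F) (functor_nt C (id_functor C) l) X = l X"
      using X F.source.Id_Comp[OF h] F.obj_map_obj[OF X]
      by (simp add: comp_nt_def nt_functor_def functor_nt_def id_nt_def id_functor_def)
  qed (simp add: comp_nt_def)
  then show ?thesis
    by (simp add: e DL_tensor_def DL_unit_def comp_functor_id_left[OF F(1)])
qed

text \<open>Here \<open>F\<close> is applied to an identity arrow, so \<open>l X\<close> is composed
  with the identity of \<open>F (B X)\<close>.\<close>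

lemma DL_tensor_unit_right:
  assumes "is_functor C C B" and x: "x \<in> DL_obj C B"
  shows "DL_tensor C x (DL_unit C B) = x"
proof -
  obtain F l where e: "x = (F, l)" by (cases x)
  note F = DL_objD[OF x[unfolded e]]
  interpret B: is_functor C C B by fact
  interpret F: is_functor C C F by fact
  interpret l: nat_trans C C "comp_functor C F B" "comp_functor C B F" l by (fact F(2))
  have "comp_nt C C (nt_functor C l (id_functor C)) (functor_nt C F (id_nt C C B)) = l"
  proof (rule extensionalityI[OF _ l.component_extensional])
    fix X assume X: "X \<in> Obj C"
    show "comp_nt C C (nt_functor C l (id_functor C)) (functor_nt C F (id_nt C C B)) X = l X"
      using X B.source.Comp_Id[OF DL_obj_component_hom[OF x[unfolded e] X]] B.obj_map_obj[OF X]
      by (simp add: comp_nt_def nt_functor_def functor_nt_def id_nt_def id_functor_def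
          F.arr_map_Id)
  qed (simp add: comp_nt_def)
  then show ?thesis
    by (simp add: e DL_tensor_def DL_unit_def comp_functor_id_right[OF F(1)])
qed

text \<open>Since \<open>F\<close> preserves composition, both laws have at \<open>X\<close> the
  component \<open>l (G (H X))\<close> after \<open>F (m (H X))\<close> after
  \<open>F (G (n X))\<close>; only the bracketing differs.\<close>

lemma DL_tensor_assoc:
  assumes B: "is_functor C C B"
    and x: "x \<in> DL_obj C B" and y: "y \<in> DL_obj C B" and z: "z \<in> DL_obj C B"
  shows "DL_tensor C (DL_tensor C x y) z = DL_tensor C x (DL_tensor C y z)"
proof -
  obtain F l G m H n where e: "x = (F, l)" "y = (G, m)" "z = (H, n)"
    by (cases x, cases y, cases z)
  note x' = x[unfolded e] and y' = y[unfolded e] and z' = z[unfolded e]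
  interpret B: is_functor C C B by fact
  interpret F: is_functor C C F by (rule DL_objD(1)[OF x'])
  interpret G: is_functor C C G by (rule DL_objD(1)[OF y'])
  interpret H: is_functor C C H by (rule DL_objD(1)[OF z'])
  have "comp_nt C C (nt_functor C (comp_nt C C (nt_functor C l G) (functor_nt C F m)) H)
        (functor_nt C (comp_functor C F G) n) =
      comp_nt C C (nt_functor C l (comp_functor C G H))
        (functor_nt C F (comp_nt C C (nt_functor C m H) (functor_nt C G n)))"
    \<comment> \<open>The instances open only the outer composite on each side; the inner ones stay
      folded, as in the goal shown below.\<close>
    unfolding comp_nt_def[of C C "nt_functor _ _ H" "functor_nt _ (comp_functor _ _ _) _"]
      comp_nt_def[of C C "nt_functor C l (comp_functor C G H)"]
  proof (rule restrict_ext)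
    fix X assume X: "X \<in> Obj C"
    note HX = H.obj_map_obj[OF X]
    note hn = DL_obj_component_hom[OF z' X] and hm = DL_obj_component_hom[OF y' HX]
      and hl = DL_obj_component_hom[OF x' G.obj_map_obj[OF HX]]
    note Gn = G.arr_map_hom[OF hn]
    show "nt_functor C (comp_nt C C (nt_functor C l G) (functor_nt C F m)) H X \<cdot>\<^bsub>C\<^esub>
          functor_nt C (comp_functor C F G) n X =
        nt_functor C l (comp_functor C G H) X \<cdot>\<^bsub>C\<^esub>
          functor_nt C F (comp_nt C C (nt_functor C m H) (functor_nt C G n)) X"
      using X HX F.arr_map_Comp[OF Gn hm]
        B.source.Comp_assoc[OF F.arr_map_hom[OF Gn] F.arr_map_hom[OF hm] hl]
      by (simp add: comp_nt_def nt_functor_def functor_nt_def arr_map_comp_functor[OF hn])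
  qed
  then show ?thesis
    by (simp add: e DL_tensor_def comp_functor_assoc[OF H.is_functor_axioms])
qed

section \<open>Tensoring a morphism with a fixed object\<close>

text \<open>Two squares are pasted: naturality of \<open>k\<close> at the arrow \<open>n X\<close>,
  then the \<open>DL\<close> square of \<open>k\<close> at the object \<open>H X\<close>.\<close>

lemma DL_morphism_tensor_right:
  assumes B: "is_functor C C B"
    and x: "x \<in> DL_obj C B" and y: "y \<in> DL_obj C B" and z: "z \<in> DL_obj C B"
    and k: "DL_morphism C B x y k"
  shows "DL_morphism C B (DL_tensor C x z) (DL_tensor C y z) (nt_functor C k (fst z))"
proof -
  obtain F l G m H n where e: "x = (F, l)" "y = (G, m)" "z = (H, n)"
    by (cases x, cases y, cases z)
  note x' = x[unfolded e] and y' = y[unfolded e] and z' = z[unfolded e]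
  interpret B: is_functor C C B by fact
  interpret H: is_functor C C H by (rule DL_objD(1)[OF z'])
  interpret k: nat_trans C C F G k using k by (auto simp: e DL_morphism_def)
  note assoc = B.source.Comp_assoc
  have "comp_nt C C (comp_nt C C (nt_functor C m H) (functor_nt C G n))
        (nt_functor C (nt_functor C k H) B) =
      comp_nt C C (functor_nt C B (nt_functor C k H))
        (comp_nt C C (nt_functor C l H) (functor_nt C F n))"
    unfolding comp_nt_def
  proof (rule restrict_ext)
    fix X assume X: "X \<in> Obj C"
    note HX = H.obj_map_obj[OF X] and BX = B.obj_map_obj[OF X]
    note BHX = B.obj_map_obj[OF HX] and HBX = H.obj_map_obj[OF BX]
    note hn = DL_obj_component_hom[OF z' X] and hl = DL_obj_component_hom[OF x' HX]
      and hm = DL_obj_component_hom[OF y' HX]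
    note Fn = k.F.arr_map_hom[OF hn] and Gn = k.G.arr_map_hom[OF hn]
      and Bk = B.arr_map_hom[OF k.component_hom[OF HX]]
    have "(m (obj_map H X) \<cdot>\<^bsub>C\<^esub> arr_map G (n X)) \<cdot>\<^bsub>C\<^esub> k (obj_map H (obj_map B X)) =
        m (obj_map H X) \<cdot>\<^bsub>C\<^esub> (k (obj_map B (obj_map H X)) \<cdot>\<^bsub>C\<^esub> arr_map F (n X))"
      using assoc[OF k.component_hom[OF HBX] Gn hm] k.naturality[OF hn] by simp
    also have "\<dots> = (arr_map B (k (obj_map H X)) \<cdot>\<^bsub>C\<^esub> l (obj_map H X)) \<cdot>\<^bsub>C\<^esub> arr_map F (n X)"
      using assoc[OF Fn k.component_hom[OF BHX] hm] DL_morphism_square[OF k[unfolded e] HX]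
      by simp
    also have "\<dots> = arr_map B (k (obj_map H X)) \<cdot>\<^bsub>C\<^esub> (l (obj_map H X) \<cdot>\<^bsub>C\<^esub> arr_map F (n X))"
      by (rule assoc[OF Fn hl Bk])
    \<comment> \<open>The restricted abstractions are the inner composites, which
      \<open>comp_nt_def\<close> has opened as well.\<close>
    finally show "(\<lambda>X\<in>Obj C. nt_functor C m H X \<cdot>\<^bsub>C\<^esub> functor_nt C G n X) X \<cdot>\<^bsub>C\<^esub>
          nt_functor C (nt_functor C k H) B X =
        functor_nt C B (nt_functor C k H) X \<cdot>\<^bsub>C\<^esub>
          (\<lambda>X\<in>Obj C. nt_functor C l H X \<cdot>\<^bsub>C\<^esub> functor_nt C F n X) X"
      using X BX by (simp add: nt_functor_def functor_nt_def)
  qed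
  then show ?thesis
    using nat_trans_nt_functor[OF H.is_functor_axioms k.nat_trans_axioms]
    by (simp add: e DL_tensor_def DL_morphism_def)
qed

text \<open>Two squares are pasted: the image under \<open>H\<close> of the \<open>DL\<close> square
  of \<open>k\<close> at \<open>X\<close>, then naturality of the law \<open>n\<close> at the arrow
  \<open>k X\<close>.\<close>

lemma DL_morphism_tensor_left:
  assumes B: "is_functor C C B"
    and x: "x \<in> DL_obj C B" and y: "y \<in> DL_obj C B" and z: "z \<in> DL_obj C B"
    and k: "DL_morphism C B x y k"
  shows "DL_morphism C B (DL_tensor C z x) (DL_tensor C z y) (functor_nt C (fst z) k)"
proof -
  obtain F l G m H n where e: "x = (F, l)" "y = (G, m)" "z = (H, n)"
    by (cases x, cases y, cases z)
  note x' = x[unfolded e] and y' = y[unfolded e] and z' = z[unfolded e]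
  interpret B: is_functor C C B by fact
  interpret H: is_functor C C H by (rule DL_objD(1)[OF z'])
  interpret k: nat_trans C C F G k using k by (auto simp: e DL_morphism_def)
  note assoc = B.source.Comp_assoc
  have "comp_nt C C (comp_nt C C (nt_functor C n G) (functor_nt C H m))
        (nt_functor C (functor_nt C H k) B) =
      comp_nt C C (functor_nt C B (functor_nt C H k))
        (comp_nt C C (nt_functor C n F) (functor_nt C H l))"
    unfolding comp_nt_def
  proof (rule restrict_ext)
    fix X assume X: "X \<in> Obj C"
    note BX = B.obj_map_obj[OF X]
    note hk = k.component_hom[OF X] and hkB = k.component_hom[OF BX]
    note hl = DL_obj_component_hom[OF x' X] and hm = DL_obj_component_hom[OF y' X]
      and hnF = DL_obj_component_hom[OF z' k.F.obj_map_obj[OF X]]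
      and hnG = DL_obj_component_hom[OF z' k.G.obj_map_obj[OF X]]
    note Hl = H.arr_map_hom[OF hl] and Bk = B.arr_map_hom[OF hk]
    note HBk = H.arr_map_hom[OF Bk] and BHk = B.arr_map_hom[OF H.arr_map_hom[OF hk]]
    have "(n (obj_map G X) \<cdot>\<^bsub>C\<^esub> arr_map H (m X)) \<cdot>\<^bsub>C\<^esub> arr_map H (k (obj_map B X)) =
        n (obj_map G X) \<cdot>\<^bsub>C\<^esub> arr_map H (m X \<cdot>\<^bsub>C\<^esub> k (obj_map B X))"
      using assoc[OF H.arr_map_hom[OF hkB] H.arr_map_hom[OF hm] hnG] H.arr_map_Comp[OF hkB hm]
      by simp
    also have "\<dots> = n (obj_map G X) \<cdot>\<^bsub>C\<^esub> (arr_map H (arr_map B (k X)) \<cdot>\<^bsub>C\<^esub> arr_map H (l X))"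
      using DL_morphism_square[OF k[unfolded e] X] H.arr_map_Comp[OF hl Bk] by simp
    also have "\<dots> = (arr_map B (arr_map H (k X)) \<cdot>\<^bsub>C\<^esub> n (obj_map F X)) \<cdot>\<^bsub>C\<^esub> arr_map H (l X)"
      using assoc[OF Hl HBk hnG] DL_obj_naturality[OF z' hk] by simp
    also have "\<dots> = arr_map B (arr_map H (k X)) \<cdot>\<^bsub>C\<^esub> (n (obj_map F X) \<cdot>\<^bsub>C\<^esub> arr_map H (l X))"
      by (rule assoc[OF Hl hnF BHk])
    finally show "(\<lambda>X\<in>Obj C. nt_functor C n G X \<cdot>\<^bsub>C\<^esub> functor_nt C H m X) X \<cdot>\<^bsub>C\<^esub>
          nt_functor C (functor_nt C H k) B X =
        functor_nt C B (functor_nt C H k) X \<cdot>\<^bsub>C\<^esub>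
          (\<lambda>X\<in>Obj C. nt_functor C n F X \<cdot>\<^bsub>C\<^esub> functor_nt C H l X) X"
      using X BX by (simp add: nt_functor_def functor_nt_def)
  qed
  then show ?thesis
    using nat_trans_functor_nt[OF H.is_functor_axioms k.nat_trans_axioms]
    by (simp add: e DL_tensor_def DL_morphism_def)
qed

section \<open>The companion as a monoid in DL\<close>

lemma companion_obj:
  "companion C B T \<tau> \<Longrightarrow> (T, \<tau>) \<in> DL_obj C B"
  by (simp add: companion_def final_object_def DL_def)

text \<open>An arrow of \<open>DL C B\<close> is a triple with its endpoints; for fixed endpoints
  only the middle entry varies, so finality becomes a statement about component families.\<close>

lemma companion_ex1:
  assumes "companion C B T \<tau>" and x: "x \<in> DL_obj C B"
  shows "\<exists>!k. DL_morphism C B x (T, \<tau>) k"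
proof -
  have "\<exists>!f. f \<in> Hom (DL C B) x (T, \<tau>)"
    using assms by (simp add: companion_def final_object_def DL_def)
  then show ?thesis
    using x companion_obj[OF assms(1)] by (auto simp: Hom_DL)
qed

text \<open>The law of \<open>DL_unit C B\<close> is an identity, so the side \<open>B\<eta>\<close>
  after this law of the morphism condition collapses to \<open>B\<eta>\<close>, leaving the unit law
  of a distributive law.\<close>

lemma DL_morphism_unit_iff:
  assumes "is_functor C C B"
  shows "DL_morphism C B (DL_unit C B) (T, \<tau>) \<eta> \<longleftrightarrow>
    nat_trans C C (id_functor C) T \<eta> \<and> functor_nt C B \<eta> = comp_nt C C \<tau> (nt_functor C \<eta> B)"
proof -
  interpret B: is_functor C C B by fact
  have "comp_nt C C (functor_nt C B \<eta>) (id_nt C C B) = functor_nt C B \<eta>"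
    if \<eta>: "nat_trans C C (id_functor C) T \<eta>"
  proof -
    interpret \<eta>: nat_trans C C "id_functor C" T \<eta> by fact
    show ?thesis
      unfolding comp_nt_def functor_nt_def
    proof (rule restrict_ext)
      fix X assume X: "X \<in> Obj C"
      then have "\<eta> X \<in> Hom C X (obj_map T X)"
        using \<eta>.component_hom[OF X] by (simp add: id_functor_def)
      from B.source.Comp_Id[OF B.arr_map_hom[OF this]]
      show "(\<lambda>X\<in>Obj C. arr_map B (\<eta> X)) X \<cdot>\<^bsub>C\<^esub> id_nt C C B X = arr_map B (\<eta> X)"
        using X by (simp add: id_nt_def)
    qed
  qed
  then show ?thesis
    by (auto simp: DL_morphism_def DL_unit_def)
qed

text \<open>The law carried by the tensor square of \<open>(T, \<tau>)\<close> is literally the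
  composite in the multiplication law, so unfolding suffices.\<close>

lemma DL_morphism_mult_iff:
  "DL_morphism C B (DL_tensor C (T, \<tau>) (T, \<tau>)) (T, \<tau>) \<mu> \<longleftrightarrow>
    nat_trans C C (comp_functor C T T) T \<mu> \<and>
    comp_nt C C \<tau> (nt_functor C \<mu> B) =
      comp_nt C C (functor_nt C B \<mu>) (comp_nt C C (nt_functor C \<tau> T) (functor_nt C T \<tau>))"
  by (simp add: DL_morphism_def DL_tensor_def)

text \<open>Each monad equation compares two \<open>DL\<close> morphisms into the final object:
  associativity on the threefold tensor power of \<open>(T, \<tau>)\<close>, the unit laws on
  \<open>(T, \<tau>)\<close> itself.\<close>

lemma companion_monoid_monad:
  assumes B: "is_functor C C B" and T: "companion C B T \<tau>"
    and \<eta>: "DL_morphism C B (DL_unit C B) (T, \<tau>) \<eta>"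
    and \<mu>: "DL_morphism C B (DL_tensor C (T, \<tau>) (T, \<tau>)) (T, \<tau>) \<mu>"
  shows "monad C T \<eta> \<mu>"
proof -
  let ?t = "(T, \<tau>)" and ?tt = "DL_tensor C (T, \<tau>) (T, \<tau>)"
  note t = companion_obj[OF T] and u = DL_unit_obj[OF B]
  note tt = DL_tensor_obj[OF B t t]
  note ttt = DL_tensor_obj[OF B t tt]
  have unique: "k = k'"
    if "x \<in> DL_obj C B" "DL_morphism C B x ?t k" "DL_morphism C B x ?t k'" for x k k'
    using companion_ex1[OF T that(1)] that(2,3) by blast
  have "DL_morphism C B (DL_tensor C ?t ?tt) ?tt (functor_nt C T \<mu>)"
    using DL_morphism_tensor_left[OF B tt t t \<mu>] by simp
  note 1 = DL_morphism_comp[OF B ttt tt t this \<mu>]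
  \<comment> \<open>Tensoring on the right gives the source bracketed to the left;
    \<open>DL_tensor_assoc\<close> rebrackets it, so that the two composites \<open>1\<close> and
    \<open>2\<close> are parallel.\<close>
  have "DL_morphism C B (DL_tensor C ?t ?tt) ?tt (nt_functor C \<mu> T)"
    using DL_morphism_tensor_right[OF B tt t t \<mu>] by (simp add: DL_tensor_assoc[OF B t t t])
  note 2 = DL_morphism_comp[OF B ttt tt t this \<mu>]
  \<comment> \<open>The source, the unit tensored with \<open>?t\<close>, is equal to
    \<open>?t\<close>, so the composite \<open>3\<close> is an endomorphism of the final object,
    comparable with the identity in \<open>5\<close>.\<close>
  have "DL_morphism C B ?t ?tt (nt_functor C \<eta> T)"
    using DL_morphism_tensor_right[OF B u t t \<eta>] by (simp add: DL_tensor_unit_left[OF B t])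
  note 3 = DL_morphism_comp[OF B t tt t this \<mu>]
  have "DL_morphism C B ?t ?tt (functor_nt C T \<eta>)"
    using DL_morphism_tensor_left[OF B u t t \<eta>] by (simp add: DL_tensor_unit_right[OF B t])
  note 4 = DL_morphism_comp[OF B t tt t this \<mu>]
  have 5: "DL_morphism C B ?t ?t (id_nt C C T)"
    using DL_morphism_id[OF B t] by simp
  show ?thesis
    using DL_objD(1)[OF t] \<eta> \<mu> unique[OF ttt 1 2] unique[OF t 3 5] unique[OF t 4 5]
    by (simp add: monad_def monad_axioms_def DL_morphism_unit_iff[OF B] DL_morphism_mult_iff)
qed

theorem theorem4p2:
  fixes C :: "('o, 'a) cat" and B T :: "('o, 'a) endo" and \<tau> :: "'o \<Rightarrow> 'a"
  assumes "category C"
    and "is_functor C C B"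
    and "companion C B T \<tau>"
  shows "\<exists>!(\<eta>, \<mu>).
    nat_trans C C (id_functor C) T \<eta> \<and>
    nat_trans C C (comp_functor C T T) T \<mu> \<and>
    monad C T \<eta> \<mu> \<and> distributive_law C T \<eta> \<mu> B \<tau>"
proof -
  note B = assms(2) and T = assms(3)
  note t = companion_obj[OF T]
  let ?U = "DL_morphism C B (DL_unit C B) (T, \<tau>)"
    and ?M = "DL_morphism C B (DL_tensor C (T, \<tau>) (T, \<tau>)) (T, \<tau>)"
  \<comment> \<open>From left to right, the two compatibility laws make \<open>\<eta>\<close> and
    \<open>\<mu>\<close> morphisms of \<open>DL\<close>. From right to left, the monad equations
    come for free from finality. The conditions thus split into one on \<open>\<eta>\<close> alone
    and one on \<open>\<mu>\<close> alone.\<close>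
  have iff: "nat_trans C C (id_functor C) T \<eta> \<and> nat_trans C C (comp_functor C T T) T \<mu> \<and>
      monad C T \<eta> \<mu> \<and> distributive_law C T \<eta> \<mu> B \<tau> \<longleftrightarrow> ?U \<eta> \<and> ?M \<mu>" for \<eta> \<mu>
    using companion_monoid_monad[OF B T, of \<eta> \<mu>] B DL_objD(2)[OF t]
    by (auto simp: distributive_law_def distributive_law_axioms_def
        DL_morphism_unit_iff[OF B] DL_morphism_mult_iff)
  \<comment> \<open>Finality is applied at the monoidal unit, and next at the tensor square of the
    companion.\<close>
  obtain \<eta> where \<eta>: "?U \<eta>" "\<And>\<eta>'. ?U \<eta>' \<Longrightarrow> \<eta>' = \<eta>"
    using companion_ex1[OF T DL_unit_obj[OF B]] by blast
  obtain \<mu> where \<mu>: "?M \<mu>" "\<And>\<mu>'. ?M \<mu>' \<Longrightarrow> \<mu>' = \<mu>"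
    using companion_ex1[OF T DL_tensor_obj[OF B t t]] by blast
  show ?thesis
    unfolding iff
  proof (rule ex1I[of _ "(\<eta>, \<mu>)"])
    show "case (\<eta>, \<mu>) of (\<eta>, \<mu>) \<Rightarrow> ?U \<eta> \<and> ?M \<mu>"
      using \<eta>(1) \<mu>(1) by simp
    show "p = (\<eta>, \<mu>)" if "case p of (\<eta>, \<mu>) \<Rightarrow> ?U \<eta> \<and> ?M \<mu>" for p
      using that \<eta>(2)[of "fst p"] \<mu>(2)[of "snd p"] by (cases p) simp
  qed
qed

end
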